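(* Let $A$ be a $C^*$-algebra, $\mathcal{H}$ a Hilbert space, $\varphi:A\to L(\mathcal{H})$ a completely positive linear map and $(\pi,\mathcal{H}_\varphi,V_\varphi)$ a minimal Stinespring dilation triple of $\varphi$. Then for every Hilbert $A$-module $X$ and every $x\in X$, the following statements are equivalent: (1) $x\in X_\varphi$; (2) $\pi(\langle y,x\rangle)\left(\mathrm{id}_{\mathcal{H}_\varphi}-V_\varphi V_\varphi^*\right)=0$ for all $y\in X$.
   Context: Hilbert $C^*$-modules are right modules, with inner product linear in the second variable. $L(\mathcal{H},\mathcal{K})$ denotes bounded linear operators, $L(\mathcal{H})=L(\mathcal{H},\mathcal{H})$, and $[\,\cdot\,]$ closed linear span. A map $\Phi:X\to L(\mathcal{H},\mathcal{K})$ is a $\varphi$-map if $\Phi(x)^*\Phi(y)=\varphi(\langle x,y\rangle)$ for all $x,y\in X$. A minimal Stinespring dilation triple of $\varphi$ is a triple $(\pi,\mathcal{H}_\varphi,V_\varphi)$ where $\pi:A\to L(\mathcal{H}_\varphi)$ is a $*$-representation, $V_\varphi:\mathcal{H}\to\mathcal{H}_\varphi$ is bounded linear, $\varphi(a)=V_\varphi^*\pi(a)V_\varphi$ for all $a\in A$, and $[\pi(A)V_\varphi\mathcal{H}]=\mathcal{H}_\varphi$. Let $M_\varphi=\{a\in A:\varphi(ab)=\varphi(a)\varphi(b),\ \varphi(ba)=\varphi(b)\varphi(a)\ \forall b\in A\}$ and $T_\varphi=\{a\in M_\varphi:\varphi(ba^*c)=\varphi(b)\varphi(a)^*\varphi(c)\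 \forall b,c\in A\}$. The ternary domain $X_\varphi$ of $\varphi$ on $X$ is the set $\{x\in X:\Phi(xb)=\Phi(x)\varphi(b)\text{ for all }b\in A\}$, where $\Phi$ is any operator-valued $\varphi$-map on $X$; such maps exist and the set is the same for every choice of $\Phi$ (equivalently $X_\varphi=\{x\in X:\langle x,x\rangle\in T_\varphi\}$). *)

theory Defs
  imports "HOL-Analysis.Analysis"
begin

section \<open>Complex vector spaces and Hilbert spaces\<close>

class scaleC = scaleR +
  fixes scaleC :: "complex \<Rightarrow> 'a \<Rightarrow> 'a" (infixr "*\<^sub>C" 75)
  assumes scaleR_scaleC: "r *\<^sub>R x = complex_of_real r *\<^sub>C x"

class complex_vector = scaleC + ab_group_add +
  assumes scaleC_add_right: "a *\<^sub>C (x + y) = a *\<^sub>C x + a *\<^sub>C y"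
    and scaleC_add_left: "(a + b) *\<^sub>C x = a *\<^sub>C x + b *\<^sub>C x"
    and scaleC_scaleC: "a *\<^sub>C (b *\<^sub>C x) = (a * b) *\<^sub>C x"
    and scaleC_one: "1 *\<^sub>C x = x"

class complex_normed_vector = complex_vector + real_normed_vector +
  assumes norm_scaleC: "norm (a *\<^sub>C x) = cmod a * norm x"

class complex_inner = complex_normed_vector +
  fixes cinner :: "'a \<Rightarrow> 'a \<Rightarrow> complex"
  assumes cinner_commute: "cinner x y = cnj (cinner y x)"
    and cinner_add_right: "cinner x (y + z) = cinner x y + cinner x z"
    and cinner_scaleC_right: "cinner x (c *\<^sub>C y) = c * cinner x y"
    and cinner_ge_zero: "0 \<le> Re (cinner x x)"
    and cinner_eq_zero_iff: "cinner x x = 0 \<longleftrightarrow> x = 0"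
    and norm_eq_sqrt_cinner: "norm x = sqrt (Re (cinner x x))"

class chilbert_space = complex_inner + complete_space

definition clinear :: "('a::complex_vector \<Rightarrow> 'b::complex_vector) \<Rightarrow> bool" where
  "clinear f \<longleftrightarrow> Vector_Spaces.linear scaleC scaleC f"

text \<open>Elements of \<open>L(H, K)\<close> are represented by functions \<open>f\<close> with \<open>bounded_clinear f\<close>.\<close>

definition bounded_clinear :: "('a::complex_normed_vector \<Rightarrow> 'b::complex_normed_vector) \<Rightarrow> bool" where
  "bounded_clinear f \<longleftrightarrow> clinear f \<and> (\<exists>K. \<forall>x. norm (f x) \<le> norm x * K)"

definition cadjoint :: "('h::chilbert_space \<Rightarrow> 'k::chilbert_space) \<Rightarrow> 'k \<Rightarrow> 'h" where
  "cadjoint f = (SOME g. \<forall>x y. cinner (f x) y = cinner x (g y))"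

definition cspan :: "'a::complex_vector set \<Rightarrow> 'a set" where
  "cspan S = module.span scaleC S"


section \<open>C*-algebras and Hilbert modules\<close>

text \<open>No unit is required, and the zero algebra is admitted.\<close>

class cstar_algebra = complex_normed_vector + real_normed_algebra + complete_space +
  fixes cstar :: "'a \<Rightarrow> 'a"
  assumes mult_scaleC_left: "(c *\<^sub>C a) * b = c *\<^sub>C (a * b)"
    and mult_scaleC_right: "a * (c *\<^sub>C b) = c *\<^sub>C (a * b)"
    and cstar_cstar: "cstar (cstar a) = a"
    and cstar_add: "cstar (a + b) = cstar a + cstar b"
    and cstar_scaleC: "cstar (c *\<^sub>C a) = cnj c *\<^sub>C cstar a"
    and cstar_mult: "cstar (a * b) = cstar b * cstar a"
    and cstar_identity: "norm (cstar a * a) = (norm a)\<^sup>2"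

definition cstar_positive :: "'a::cstar_algebra \<Rightarrow> bool" where
  "cstar_positive a \<longleftrightarrow> (\<exists>b. a = cstar b * b)"

text \<open>Right Hilbert modules, with action \<open>act\<close> and inner product \<open>ip\<close>. The last assumption, together
  with the sort \<open>complete_space\<close>, expresses completeness in the norm defined by \<open>ip\<close>.\<close>

locale hilbert_module =
  fixes act :: "'x::{complex_normed_vector, complete_space} \<Rightarrow> 'a::cstar_algebra \<Rightarrow> 'x"
    and ip :: "'x \<Rightarrow> 'x \<Rightarrow> 'a"
  assumes act_add_left: "act (x + y) a = act x a + act y a"
    and act_add_right: "act x (a + b) = act x a + act x b"
    and act_mult: "act x (a * b) = act (act x a) b"
    and act_scaleC_left: "act (c *\<^sub>C x) a = c *\<^sub>C act x a"
    and act_scaleC_right: "act x (c *\<^sub>C a) = c *\<^sub>C act x a"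
    and ip_add_right: "ip x (y + z) = ip x y + ip x z"
    and ip_scaleC_right: "ip x (c *\<^sub>C y) = c *\<^sub>C ip x y"
    and ip_act_right: "ip x (act y a) = ip x y * a"
    and ip_commute: "ip x y = cstar (ip y x)"
    and ip_positive: "cstar_positive (ip x x)"
    and ip_eq_zero_iff: "ip x x = 0 \<longleftrightarrow> x = 0"
    and norm_eq_sqrt_ip: "norm x = sqrt (norm (ip x x))"


section \<open>Completely positive maps and Stinespring triples\<close>

definition linear_into_L ::
    "('a::cstar_algebra \<Rightarrow> 'h::chilbert_space \<Rightarrow> 'k::chilbert_space) \<Rightarrow> bool" where
  "linear_into_L \<phi> \<longleftrightarrow> (\<forall>a. bounded_clinear (\<phi> a)) \<and> (\<forall>h. clinear (\<lambda>a. \<phi> a h))"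

text \<open>Positivity in \<open>M\<^sub>n(A)\<close>: the matrix has the form \<open>B\<^sup>*B\<close> with \<open>B\<close> in \<open>M\<^sub>n(A)\<close>.\<close>

definition matrix_positive :: "nat \<Rightarrow> (nat \<Rightarrow> nat \<Rightarrow> 'a::cstar_algebra) \<Rightarrow> bool" where
  "matrix_positive n M \<longleftrightarrow> (\<exists>B. \<forall>i<n. \<forall>j<n. M i j = (\<Sum>k<n. cstar (B k i) * B k j))"

text \<open>Positivity in \<open>M\<^sub>n(L(H)) = L(H\<^sup>n)\<close>.\<close>

definition operator_matrix_positive ::
    "nat \<Rightarrow> (nat \<Rightarrow> nat \<Rightarrow> 'h::chilbert_space \<Rightarrow> 'h) \<Rightarrow> bool" where
  "operator_matrix_positive n T \<longleftrightarrow>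
     (\<forall>h. (\<Sum>i<n. \<Sum>j<n. cinner (h i) (T i j (h j))) \<in> \<real>\<^sub>\<ge>\<^sub>0)"

definition completely_positive_map :: "('a::cstar_algebra \<Rightarrow> 'h::chilbert_space \<Rightarrow> 'h) \<Rightarrow> bool" where
  "completely_positive_map \<phi> \<longleftrightarrow> linear_into_L \<phi> \<and>
     (\<forall>n M. matrix_positive n M \<longrightarrow> operator_matrix_positive n (\<lambda>i j. \<phi> (M i j)))"

definition star_representation :: "('a::cstar_algebra \<Rightarrow> 'h::chilbert_space \<Rightarrow> 'h) \<Rightarrow> bool" where
  "star_representation \<pi> \<longleftrightarrow> linear_into_L \<pi> \<and>
     (\<forall>a b. \<pi> (a * b) = \<pi> a \<circ> \<pi> b) \<and> (\<forall>a. \<pi> (cstar a) = cadjoint (\<pi> a))"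

definition minimal_stinespring_triple ::
    "('a::cstar_algebra \<Rightarrow> 'h::chilbert_space \<Rightarrow> 'h) \<Rightarrow> ('a \<Rightarrow> 'd::chilbert_space \<Rightarrow> 'd) \<Rightarrow>
     ('h \<Rightarrow> 'd) \<Rightarrow> bool" where
  "minimal_stinespring_triple \<phi> \<pi> V \<longleftrightarrow>
     star_representation \<pi> \<and> bounded_clinear V \<and>
     (\<forall>a. \<phi> a = cadjoint V \<circ> \<pi> a \<circ> V) \<and>
     closure (cspan {\<pi> a (V h) | a h. True}) = UNIV"


section \<open>\<open>\<phi>\<close>-maps and the ternary domain\<close>

text \<open>Linearity of \<open>\<Phi>\<close> is not part of the definition.\<close>

definition phi_map ::
    "('x \<Rightarrow> 'x \<Rightarrow> 'a) \<Rightarrow> ('a::cstar_algebra \<Rightarrow> 'h::chilbert_space \<Rightarrow> 'h) \<Rightarrow>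
     ('x \<Rightarrow> 'h \<Rightarrow> 'k::chilbert_space) \<Rightarrow> bool" where
  "phi_map ip \<phi> \<Phi> \<longleftrightarrow> (\<forall>x. bounded_clinear (\<Phi> x)) \<and>
     (\<forall>x y. cadjoint (\<Phi> x) \<circ> \<Phi> y = \<phi> (ip x y))"

text \<open>The ternary domain of \<open>\<phi>\<close>, computed with a \<open>\<phi>\<close>-map \<open>\<Phi>\<close>. The set does not depend on \<open>\<Phi>\<close>; as
  \<open>\<Phi>\<close> takes values in \<open>L(H, K)\<close> for a Hilbert space \<open>K\<close> of any type, it is kept as a parameter.\<close>

definition ternary_domain ::
    "('x \<Rightarrow> 'a \<Rightarrow> 'x) \<Rightarrow> ('a::cstar_algebra \<Rightarrow> 'h::chilbert_space \<Rightarrow> 'h) \<Rightarrow>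
     ('x \<Rightarrow> 'h \<Rightarrow> 'k::chilbert_space) \<Rightarrow> 'x set" where
  "ternary_domain act \<phi> \<Phi> = {x. \<forall>b. \<Phi> (act x b) = \<Phi> x \<circ> \<phi> b}"

end

theory Submission
  imports Defs
begin

text \<open>
  Put \<open>P = id - V V\<^sup>*\<close>. Since \<open>\<phi>(a) = V\<^sup>* \<pi>(a) V\<close> and \<open>\<Phi>\<close> is a \<open>\<phi>\<close>-map, expanding the square gives
  \<open>\<parallel>\<Phi>(xb)h - \<Phi>(x)\<phi>(b)h\<parallel>\<^sup>2 = \<langle>P\<xi>, \<pi>(\<langle>x,x\<rangle>) P\<xi>\<rangle>\<close> with \<open>\<xi> = \<pi>(b) V h\<close>,
  which is lemma \<open>norm_phi_map_defect\<close>. Hence \<open>x\<close> lies in the ternary domain if and only if the right-hand side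
  vanishes for all \<open>\<xi>\<close> of the form \<open>\<pi>(b) V h\<close>. If \<open>\<pi>(\<langle>y,x\<rangle>) P = 0\<close> for all \<open>y\<close>, then it does, by \<open>y = x\<close>.

  For the converse, fix \<open>\<eta> = P \<pi>(b) V h\<close>. The sesquilinear form \<open>(y, z) \<mapsto> \<langle>\<eta>, \<pi>(\<langle>y,z\<rangle>) \<eta>\<rangle>\<close> on \<open>X\<close> is positive
  semidefinite, so \<open>x\<close>, being isotropic, is orthogonal to every vector for this form. Orthogonality to
  \<open>y\<langle>y,x\<rangle>\<close> says that \<open>\<pi>(\<langle>y,x\<rangle>) \<eta>\<close> has norm \<open>0\<close> (lemma \<open>representation_ip_eq_zero\<close>). This replaces the
  Cauchy-Schwarz inequality of Hilbert modules, which needs the order of the C*-algebra, by that of a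
  scalar form. So \<open>\<pi>(\<langle>y,x\<rangle>) P\<close> vanishes on all \<open>\<pi>(b) V h\<close>, and by minimality everywhere
  (lemma \<open>eq_zero_if_zero_on_dense_span\<close>).

  Since \<open>cadjoint\<close> is defined by choice, all this rests on the existence of adjoints, that is on the
  Riesz representation theorem, which is derived from a minimisation argument.
\<close>

section \<open>Complex inner products and linear maps\<close>

interpretation complex_vector: vector_space "scaleC :: complex \<Rightarrow> 'a \<Rightarrow> 'a::complex_vector"
  by unfold_locales (simp_all add: scaleC_add_right scaleC_add_left scaleC_scaleC scaleC_one)

lemma additive_cinner_right: "Modules.additive (cinner x)"
  by unfold_locales (rule cinner_add_right)

lemmas cinner_diff_right = additive.diff[OF additive_cinner_right]
  and cinner_zero_right = additive.zero[OF additive_cinner_right]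

lemma cinner_add_left: "cinner (x + y) z = cinner x z + cinner y z"
  by (metis cinner_add_right cinner_commute complex_cnj_add)

lemma cinner_diff_left: "cinner (x - y) z = cinner x z - cinner y z"
  by (metis cinner_diff_right cinner_commute complex_cnj_diff)

lemma cinner_zero_left: "cinner 0 z = 0"
  by (metis cinner_zero_right cinner_commute complex_cnj_zero)

lemma cinner_scaleR_right: "cinner x (r *\<^sub>R y) = complex_of_real r * cinner x y"
  by (simp add: scaleR_scaleC cinner_scaleC_right)

lemma Re_cinner_commute: "Re (cinner x y) = Re (cinner y x)"
  by (subst cinner_commute) simp

lemma cinner_self: "cinner x x = complex_of_real ((norm x)\<^sup>2)"
proof -
  have "Im (cinner x x) = 0"
    using arg_cong[OF cinner_commute[of x x], of Im] by simp
  then show ?thesis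
    by (simp add: complex_eq_iff norm_eq_sqrt_cinner cinner_ge_zero)
qed

lemma norm_add_sq: "(norm (x + y))\<^sup>2 = (norm x)\<^sup>2 + 2 * Re (cinner x y) + (norm y)\<^sup>2"
proof -
  have "complex_of_real ((norm (x + y))\<^sup>2) = cinner x x + cinner x y + cinner y x + cinner y y"
    by (simp only: cinner_self[symmetric] cinner_add_left cinner_add_right add.assoc add.left_commute)
  from arg_cong[OF this, of Re] show ?thesis
    using Re_cinner_commute[of y x] by (simp add: cinner_self)
qed

text \<open>By polarisation, this form of the Cauchy-Schwarz inequality is equivalent to the triangle inequality,
  which the norm satisfies by its class.\<close>

lemma Re_cinner_le: "Re (cinner x y) \<le> norm x * norm (y::'a::complex_inner)"
proof -
  have "(norm (x + y))\<^sup>2 \<le> (norm x + norm y)\<^sup>2"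
    by (simp add: norm_triangle_ineq power_mono)
  then show ?thesis
    by (simp add: norm_add_sq power2_sum)
qed

lemma cinner_eqI_Re:
  assumes "\<And>w. Re (cinner w u) = Re (cinner w v)"
  shows "u = (v::'a::complex_inner)"
proof -
  have "Re (cinner (u - v) (u - v)) = 0"
    using assms by (simp add: cinner_diff_right)
  then show ?thesis
    by (simp add: cinner_self)
qed

lemma clinear_iff:
  "clinear f \<longleftrightarrow> (\<forall>x y. f (x + y) = f x + f y) \<and> (\<forall>c x. f (c *\<^sub>C x) = c *\<^sub>C f x)"
  unfolding clinear_def Vector_Spaces.linear_iff
  by (simp add: complex_vector.vector_space_axioms)

lemma additive_clinear: "clinear f \<Longrightarrow> Modules.additive f"
  by unfold_locales (simp add: clinear_iff)

lemma bounded_clinear_imp_clinear: "bounded_clinear f \<Longrightarrow> clinear f"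
  by (simp add: bounded_clinear_def)

lemmas clinear_diff = additive.diff[OF additive_clinear]

lemma bounded_linear_if_bounded_clinear: "bounded_clinear f \<Longrightarrow> bounded_linear f"
  unfolding bounded_clinear_def clinear_iff
  by (auto intro!: bounded_linear.intro linearI bounded_linear_axioms.intro simp: scaleR_scaleC)


section \<open>Riesz representation and adjoints\<close>

text \<open>The representing vector is the point where \<open>J(x) = \<parallel>x\<parallel>\<^sup>2 - 2 g(x)\<close> attains its infimum: by the
  parallelogram law every minimising sequence is Cauchy, and the derivative of \<open>J\<close> at the minimum is
  \<open>w \<mapsto> 2 Re \<langle>z, w\<rangle> - 2 g(w)\<close>.\<close>

lemma riesz_representation_real:
  fixes g :: "'h::chilbert_space \<Rightarrow> real"
  assumes "bounded_linear g"
  shows "\<exists>z. \<forall>w. g w = Re (cinner z w)"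
proof -
  interpret g: bounded_linear g by fact
  define J where "J x = (norm x)\<^sup>2 - 2 * g x" for x
  obtain K where K: "\<And>x. norm (g x) \<le> norm x * K"
    using g.bounded by blast
  have "- K\<^sup>2 \<le> J x" for x
  proof -
    have "g x \<le> norm x * K" using K[of x] by auto
    moreover have "0 \<le> (norm x - K)\<^sup>2" by simp
    ultimately show ?thesis by (simp add: J_def power2_diff)
  qed
  then have bdd: "bdd_below (range J)" by (auto simp: bdd_below_def)
  define m where "m = Inf (range J)"
  have m_le: "m \<le> J x" for x
    unfolding m_def using bdd by (auto intro: cInf_lower)
  have shift: "J (x + w) = J x + 2 * (Re (cinner x w) - g w) + (norm w)\<^sup>2" for x w
    by (simp add: J_def norm_add_sq g.add)
  have para: "(norm (x - y))\<^sup>2 \<le> 2 * (J x + J y - 2 * m)" for x y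
  proof -
    define c where "c = (1/2) *\<^sub>R (x + y)"
    define d where "d = (1/2) *\<^sub>R (x - y)"
    have "c + d = (1/2) *\<^sub>R (x + x)" "c + (-1) *\<^sub>R d = (1/2) *\<^sub>R (y + y)"
      by (simp_all add: c_def d_def algebra_simps)
    then have x: "x = c + d" and y: "y = c + (-1) *\<^sub>R d"
      by (simp_all only: scaleR_half_double)
    have "J x + J y = 2 * J c + 2 * (norm d)\<^sup>2"
      unfolding x y shift
      by (simp only: cinner_scaleR_right g.scaleR norm_scaleR) (simp add: algebra_simps)
    moreover have "(norm d)\<^sup>2 = (norm (x - y))\<^sup>2 / 4"
      by (simp add: d_def power_divide)
    ultimately show ?thesis using m_le[of c] by simp
  qed
  have "\<exists>x. J x < m + inverse (real (Suc n))" for n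
    using cInf_lessD[of "range J" "m + inverse (real (Suc n))"] by (auto simp: m_def)
  then obtain X where X: "\<And>n. J (X n) < m + inverse (real (Suc n))" by metis
  have J_lim: "(\<lambda>n. J (X n)) \<longlonglongrightarrow> m"
  proof (rule tendsto_sandwich[OF _ _ tendsto_const])
    show "(\<lambda>n. m + inverse (real (Suc n))) \<longlonglongrightarrow> m"
      using tendsto_add[OF tendsto_const[of m] LIMSEQ_inverse_real_of_nat] by simp
  qed (use m_le X in \<open>auto intro!: always_eventually less_imp_le\<close>)
  have "Cauchy X"
  proof (rule metric_CauchyI)
    fix e :: real assume "0 < e"
    then have "0 < e\<^sup>2 / 4" by simp
    from LIMSEQ_D[OF J_lim this] obtain N where N: "\<And>n. n \<ge> N \<Longrightarrow> \<bar>J (X n) - m\<bar> < e\<^sup>2 / 4"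
      by auto
    have "dist (X i) (X j) < e" if "i \<ge> N" "j \<ge> N" for i j
    proof -
      have "(norm (X i - X j))\<^sup>2 < e\<^sup>2"
        using para[of "X i" "X j"] N[OF that(1)] N[OF that(2)] by argo
      then show ?thesis
        using \<open>0 < e\<close> by (simp add: dist_norm power2_less_imp_less)
    qed
    then show "\<exists>M. \<forall>i\<ge>M. \<forall>j\<ge>M. dist (X i) (X j) < e" by blast
  qed
  then obtain z where "X \<longlonglongrightarrow> z"
    using Cauchy_convergent convergentD by blast
  then have "(\<lambda>n. J (X n)) \<longlonglongrightarrow> J z"
    unfolding J_def by (intro tendsto_intros g.tendsto)
  with J_lim have "J z = m" using LIMSEQ_unique by blast
  have le: "g w \<le> Re (cinner z w)" for w
  proof (rule ccontr)
    assume not_le: "\<not> ?thesis"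
    define \<delta> where "\<delta> = g w - Re (cinner z w)"
    have "\<delta> > 0" using not_le by (simp add: \<delta>_def)
    have "w \<noteq> 0"
      using \<open>\<delta> > 0\<close> by (auto simp: \<delta>_def g.zero cinner_zero_right)
    \<comment> \<open>the minimiser of \<open>t \<mapsto> J(z + t w) - m = - 2 t \<delta> + t\<^sup>2 \<parallel>w\<parallel>\<^sup>2\<close>\<close>
    define t where "t = \<delta> / (norm w)\<^sup>2"
    have t: "t > 0" "t * (norm w)\<^sup>2 = \<delta>"
      using \<open>w \<noteq> 0\<close> \<open>\<delta> > 0\<close> by (simp_all add: t_def)
    have "J (z + t *\<^sub>R w) = m + 2 * (t * Re (cinner z w) - t * g w) + t * (t * (norm w)\<^sup>2)"
      unfolding shift \<open>J z = m\<close>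
      by (simp add: cinner_scaleR_right g.scaleR power_mult_distrib power2_eq_square)
    also have "\<dots> = m - t * \<delta>"
      unfolding t(2) by (simp add: \<delta>_def algebra_simps)
    also have "\<dots> < m"
      using t(1) \<open>\<delta> > 0\<close> by simp
    finally show False using m_le[of "z + t *\<^sub>R w"] by simp
  qed
  have "g w = Re (cinner z w)" for w
    using le[of w] le[of "- w"] additive.minus[OF additive_cinner_right, of z w]
    by (simp add: g.neg)
  then show ?thesis by blast
qed

text \<open>The real part of a sesquilinear form determines the form, because it can also be evaluated at \<open>\<i> x\<close>.
  Representing real functionals is therefore enough.\<close>

lemma cinner_cadjoint:
  fixes f :: "'h::chilbert_space \<Rightarrow> 'k::chilbert_space"
  assumes "bounded_clinear f"
  shows "cinner (f x) y = cinner x (cadjoint f y)"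
proof -
  interpret f: bounded_linear f
    using assms by (rule bounded_linear_if_bounded_clinear)
  have scale: "f (c *\<^sub>C x) = c *\<^sub>C f x" for c x
    using assms by (simp add: bounded_clinear_def clinear_iff)
  have "\<exists>z. \<forall>x. cinner (f x) y = cinner x z" for y
  proof -
    obtain K where K: "\<And>x. norm (f x) \<le> norm x * K"
      using f.bounded by blast
    have bound: "Re (cinner y (f w)) \<le> norm w * (norm y * K)" for w
    proof -
      have "Re (cinner y (f w)) \<le> norm y * norm (f w)" by (rule Re_cinner_le)
      also have "\<dots> \<le> norm y * (norm w * K)" by (intro mult_left_mono K norm_ge_zero)
      finally show ?thesis by (simp add: mult_ac)
    qed
    have "bounded_linear (\<lambda>x. Re (cinner y (f x)))"
    proof (rule bounded_linear_intro)
      show "norm (Re (cinner y (f x))) \<le> norm x * (norm y * K)" for x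
        using bound[of x] bound[of "- x"]
        by (simp add: f.neg additive.minus[OF additive_cinner_right] abs_le_iff)
    qed (simp_all add: f.add cinner_add_right f.scaleR cinner_scaleR_right)
    from riesz_representation_real[OF this] obtain z
      where z: "\<And>x. Re (cinner y (f x)) = Re (cinner z x)" by blast
    have eq: "cinner y (f x) = cinner z x" for x
      using z[of x] z[of "\<i> *\<^sub>C x"] by (simp add: scale cinner_scaleC_right complex_eq_iff)
    have "cinner (f x) y = cinner x z" for x
      unfolding cinner_commute[of "f x" y] cinner_commute[of x z] eq ..
    then show ?thesis by blast
  qed
  then have "\<forall>y. \<exists>z. \<forall>x. cinner (f x) y = cinner x z" ..
  from choice[OF this] have "\<exists>g. \<forall>x y. cinner (f x) y = cinner x (g y)" by blast
  from someI_ex[OF this] show ?thesis unfolding cadjoint_def by (elim allE)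
qed

lemma cinner_cadjoint_left:
  "bounded_clinear f \<Longrightarrow> cinner (cadjoint f y) x = cinner y (f x)"
  using arg_cong[OF cinner_cadjoint[of f x y], of cnj] by (simp flip: cinner_commute)

text \<open>By Pythagoras the distance of \<open>u\<close> to any element of the span is at least \<open>\<parallel>u\<parallel>\<close>.\<close>

lemma eq_zero_if_orthogonal_to_dense_span:
  fixes u :: "'a::complex_inner"
  assumes dense: "closure (cspan S) = UNIV"
    and orth: "\<And>s. s \<in> S \<Longrightarrow> cinner u s = 0"
  shows "u = 0"
proof (rule ccontr)
  assume "u \<noteq> 0"
  have "u \<in> closure (cspan S)" using dense by simp
  then obtain s where s: "s \<in> cspan S" "dist s u < norm u"
    using \<open>u \<noteq> 0\<close> unfolding closure_approachable by (metis zero_less_norm_iff)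
  have "complex_vector.subspace {s. cinner u s = 0}"
    by (rule complex_vector.subspaceI) (simp_all add: cinner_zero_right cinner_add_right cinner_scaleC_right)
  with s(1) orth have "cinner u s = 0"
    unfolding cspan_def using complex_vector.span_minimal[of S "{s. cinner u s = 0}"] by blast
  then have "(norm (u + (- s)))\<^sup>2 = (norm u)\<^sup>2 + (norm s)\<^sup>2"
    unfolding norm_add_sq by (simp add: additive.minus[OF additive_cinner_right])
  then have "(norm u)\<^sup>2 \<le> (norm (u - s))\<^sup>2" by simp
  then have "norm u \<le> norm (u - s)" by (rule power2_le_imp_le) simp
  with s(2) show False by (simp add: dist_norm norm_minus_commute)
qed

text \<open>That \<open>T\<close> vanishes on \<open>S\<close> says that the range of its formal adjoint \<open>T'\<close> is orthogonal to \<open>S\<close>, so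
  \<open>T'\<close> is zero.\<close>

lemma eq_zero_if_zero_on_dense_span:
  fixes T :: "'a::complex_inner \<Rightarrow> 'b::complex_inner"
  assumes adj: "\<And>w \<xi>. cinner w (T \<xi>) = cinner (T' w) \<xi>"
    and dense: "closure (cspan S) = UNIV"
    and zero: "\<And>s. s \<in> S \<Longrightarrow> T s = 0"
  shows "T \<xi> = 0"
proof -
  have "T' w = 0" for w
    using dense by (rule eq_zero_if_orthogonal_to_dense_span) (simp add: adj[symmetric] zero cinner_zero_right)
  then show ?thesis
    by (intro cinner_eqI_Re) (simp add: adj cinner_zero_left cinner_zero_right)
qed


section \<open>Representations applied to module inner products\<close>

lemma star_representationD:
  assumes "star_representation \<pi>"
  shows "bounded_clinear (\<pi> a)"
    and "Modules.additive (\<lambda>a. \<pi> a \<xi>)"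
    and "\<pi> (a * b) \<xi> = \<pi> a (\<pi> b \<xi>)"
    and "cinner \<xi> (\<pi> (cstar a) \<eta>) = cinner (\<pi> a \<xi>) \<eta>"
  using assms
  by (auto simp: star_representation_def linear_into_L_def cinner_cadjoint intro: additive_clinear)

context hilbert_module
begin

lemma ip_add_left: "ip (x + y) z = ip x z + ip y z"
  using arg_cong[OF ip_add_right[of z x y], of cstar] by (simp add: cstar_add flip: ip_commute)

lemma ip_act_left: "ip (act x a) y = cstar a * ip x y"
  using arg_cong[OF ip_act_right[of y x a], of cstar] by (simp add: cstar_mult flip: ip_commute)

lemma ip_scaleR_right: "ip x (r *\<^sub>R y) = r *\<^sub>R ip x y"
  by (simp add: scaleR_scaleC ip_scaleC_right)

lemma ip_scaleR_left: "ip (r *\<^sub>R x) y = r *\<^sub>R ip x y"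
  using arg_cong[OF ip_scaleR_right[of y r x], of cstar]
  by (simp add: scaleR_scaleC cstar_scaleC flip: ip_commute)

text \<open>The isotropic vector \<open>x\<close> of the positive semidefinite form \<open>F(y, z) = \<langle>\<eta>, \<pi>(\<langle>y,z\<rangle>) \<eta>\<rangle>\<close>
  satisfies \<open>F(w, x) = 0\<close> for all \<open>w\<close>. With \<open>w = y\<langle>y,x\<rangle>\<close> one has \<open>\<langle>w,x\<rangle> = \<langle>y,x\<rangle>\<^sup>*\<langle>y,x\<rangle>\<close>, so that
  \<open>F(w, x) = \<parallel>\<pi>(\<langle>y,x\<rangle>) \<eta>\<parallel>\<^sup>2\<close>.\<close>

lemma representation_ip_eq_zero:
  fixes \<pi> :: "'a \<Rightarrow> 'd::chilbert_space \<Rightarrow> 'd"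
  assumes rep: "star_representation \<pi>"
    and null: "cinner \<eta> (\<pi> (ip x x) \<eta>) = 0"
  shows "\<pi> (ip y x) \<eta> = 0"
proof (rule ccontr)
  assume nonzero: "\<not> ?thesis"
  note repD = star_representationD[OF rep]
  define F where "F y z = Re (cinner \<eta> (\<pi> (ip y z) \<eta>))" for y z
  have \<pi>_scaleR: "\<pi> (r *\<^sub>R a) \<xi> = r *\<^sub>R \<pi> a \<xi>" for r a \<xi>
    using rep by (simp add: star_representation_def linear_into_L_def clinear_iff scaleR_scaleC)
  have F_pos: "0 \<le> F z z" for z
  proof -
    obtain b where "ip z z = cstar b * b"
      using ip_positive[of z] by (auto simp: cstar_positive_def)
    then show ?thesis
      by (simp add: F_def repD(3,4) cinner_ge_zero)
  qed
  have F_commute: "F w x = F x w" for w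
    using repD(4)[of \<eta> "ip w x" \<eta>]
    unfolding F_def ip_commute[of x w] by (simp add: Re_cinner_commute)
  define w where "w = act y (ip y x)"
  define q where "q = (norm (\<pi> (ip y x) \<eta>))\<^sup>2"
  have "q > 0" using nonzero by (simp add: q_def)
  have "F w x = q"
    by (simp add: F_def w_def q_def ip_act_left repD(3,4) cinner_self)
  moreover have "F x x = 0" using null by (simp add: F_def)
  ultimately have F_shift: "F (w + r *\<^sub>R x) (w + r *\<^sub>R x) = F w w + 2 * r * q" for r
    using F_commute[of w]
    by (simp add: F_def ip_add_left ip_add_right ip_scaleR_left ip_scaleR_right \<pi>_scaleR
        additive.add[OF repD(2)] cinner_add_right cinner_scaleR_right algebra_simps)
  \<comment> \<open>An affine function of \<open>r\<close> with slope \<open>2 q > 0\<close> takes negative values.\<close>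
  have "F w w + 2 * (- (F w w + 1) / (2 * q)) * q < 0"
    using \<open>q > 0\<close> by (simp add: field_simps)
  then show False
    using F_pos[of "w + (- (F w w + 1) / (2 * q)) *\<^sub>R x"] unfolding F_shift by linarith
qed

end


section \<open>The ternary domain\<close>

text \<open>With \<open>u = \<pi>(b) V h\<close> and \<open>v = V V\<^sup>* u = V \<phi>(b) h\<close>, each of the four terms in the expansion of the
  square on the left is a value of \<open>(\<xi>, \<eta>) \<mapsto> \<langle>\<xi>, \<pi>(\<langle>x,x\<rangle>) \<eta>\<rangle>\<close> at two vectors among \<open>u\<close> and \<open>v\<close>.\<close>

lemma norm_phi_map_defect:
  assumes stine: "minimal_stinespring_triple \<phi> \<pi> V"
    and hm: "hilbert_module act ip"
    and phi: "phi_map ip \<phi> \<Phi>"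
  defines "P \<equiv> \<lambda>\<xi>. \<xi> - V (cadjoint V \<xi>)"
  shows "complex_of_real ((norm (\<Phi> (act x b) h - \<Phi> x (\<phi> b h)))\<^sup>2) =
    cinner (P (\<pi> b (V h))) (\<pi> (ip x x) (P (\<pi> b (V h))))"
proof -
  interpret hilbert_module act ip by fact
  from stine have rep: "star_representation \<pi>" and V: "bounded_clinear V"
    and \<phi>: "\<And>a h. \<phi> a h = cadjoint V (\<pi> a (V h))"
    by (auto simp: minimal_stinespring_triple_def)
  note repD = star_representationD[OF rep]
  have \<Phi>: "cinner (\<Phi> y h) (\<Phi> z k) = cinner (V h) (\<pi> (ip y z) (V k))" for y z h k
  proof -
    have "bounded_clinear (\<Phi> y)" and "cadjoint (\<Phi> y) (\<Phi> z k) = \<phi> (ip y z) k"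
      using phi by (auto simp: phi_map_def fun_eq_iff)
    then have "cinner (\<Phi> y h) (\<Phi> z k) = cinner h (\<phi> (ip y z) k)"
      by (simp add: cinner_cadjoint)
    then show ?thesis
      using V by (simp add: \<phi> cinner_cadjoint)
  qed
  show ?thesis
    unfolding cinner_self[symmetric] P_def
    by (simp add: \<Phi> \<phi> cinner_diff_left cinner_diff_right
        ip_act_left ip_act_right repD(3,4) clinear_diff[OF bounded_clinear_imp_clinear[OF repD(1)]])
qed

theorem corollary4p5:
  fixes \<phi> :: "'a::cstar_algebra \<Rightarrow> 'h::chilbert_space \<Rightarrow> 'h"
    and \<pi> :: "'a \<Rightarrow> 'd::chilbert_space \<Rightarrow> 'd"
    and V :: "'h \<Rightarrow> 'd"
    and act :: "'x::{complex_normed_vector, complete_space} \<Rightarrow> 'a \<Rightarrow> 'x"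
    and ip :: "'x \<Rightarrow> 'x \<Rightarrow> 'a"
    and \<Phi> :: "'x \<Rightarrow> 'h \<Rightarrow> 'k::chilbert_space"
    and x :: 'x
  assumes "completely_positive_map \<phi>"
    and "minimal_stinespring_triple \<phi> \<pi> V"
    and "hilbert_module act ip"
    and "phi_map ip \<phi> \<Phi>"
  shows "x \<in> ternary_domain act \<phi> \<Phi> \<longleftrightarrow>
    (\<forall>y. \<pi> (ip y x) \<circ> (\<lambda>\<xi>. \<xi> - V (cadjoint V \<xi>)) = (\<lambda>_. 0))"
proof -
  interpret hilbert_module act ip by fact
  from assms(2) have rep: "star_representation \<pi>" and V: "bounded_clinear V"
    and dense: "closure (cspan {\<pi> a (V h) | a h. True}) = UNIV"
    by (auto simp: minimal_stinespring_triple_def)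
  note repD = star_representationD[OF rep]
  define P where "P \<xi> = \<xi> - V (cadjoint V \<xi>)" for \<xi>
  have P_adj: "cinner \<xi> (P \<eta>) = cinner (P \<xi>) \<eta>" for \<xi> \<eta>
    by (simp add: P_def cinner_diff_left cinner_diff_right cinner_cadjoint[OF V]
        cinner_cadjoint_left[OF V, symmetric])
  have defect: "complex_of_real ((norm (\<Phi> (act x b) h - \<Phi> x (\<phi> b h)))\<^sup>2) =
      cinner (P (\<pi> b (V h))) (\<pi> (ip x x) (P (\<pi> b (V h))))" for b h
    unfolding P_def using assms(2,3,4) by (rule norm_phi_map_defect)
  have "x \<in> ternary_domain act \<phi> \<Phi> \<longleftrightarrow>
      (\<forall>b h. complex_of_real ((norm (\<Phi> (act x b) h - \<Phi> x (\<phi> b h)))\<^sup>2) = 0)"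
    by (simp add: ternary_domain_def fun_eq_iff)
  also have "\<dots> \<longleftrightarrow> (\<forall>b h. cinner (P (\<pi> b (V h))) (\<pi> (ip x x) (P (\<pi> b (V h)))) = 0)"
    unfolding defect ..
  also have "\<dots> \<longleftrightarrow> (\<forall>y \<xi>. \<pi> (ip y x) (P \<xi>) = 0)"
  proof
    assume null: "\<forall>b h. cinner (P (\<pi> b (V h))) (\<pi> (ip x x) (P (\<pi> b (V h)))) = 0"
    show "\<forall>y \<xi>. \<pi> (ip y x) (P \<xi>) = 0"
    proof (intro allI)
      fix y \<xi>
      show "\<pi> (ip y x) (P \<xi>) = 0"
      proof (rule eq_zero_if_zero_on_dense_span[where T = "\<lambda>\<xi>. \<pi> (ip y x) (P \<xi>)"
            and T' = "\<lambda>w. P (\<pi> (ip x y) w)", OF _ dense])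
        show "cinner w (\<pi> (ip y x) (P \<xi>)) = cinner (P (\<pi> (ip x y) w)) \<xi>" for w \<xi>
          using repD(4)[of w "ip x y" "P \<xi>"] unfolding ip_commute[of y x] P_adj[symmetric] by simp
        show "\<pi> (ip y x) (P s) = 0" if "s \<in> {\<pi> a (V h) | a h. True}" for s
          using that null representation_ip_eq_zero[OF rep] by blast
      qed
    qed
  qed (simp add: cinner_zero_right)
  finally show ?thesis
    by (simp add: P_def fun_eq_iff)
qed

end
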